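(* Suppose $F(x,y)$ is a universal function, $F:2^\omega\times2^\omega\to2^\omega$. Then $F(F(x,y),z)$ is a 3-dimensional universal function.
   Context: A function $F:2^\omega\times 2^\omega\to 2^\omega$ is universal iff for every $G:2^\omega\times 2^\omega\to 2^\omega$ there is $g:2^\omega\to2^\omega$ such that $G(x,y)=F(g(x),g(y))$ for all $x,y\in2^\omega$. A $k$-dimensional universal function is a function $F:(2^\omega)^k\to2^\omega$ such that for every function $G:(2^\omega)^k\to2^\omega$ there is $h:2^\omega\to2^\omega$ such that $G(x_1,x_2,\ldots,x_k)=F(h(x_1),h(x_2),\ldots,h(x_k))$ for all $(x_1,\ldots,x_k)\in(2^\omega)^k$. *)

theory Defs
  imports "HOL-Analysis.Finite_Cartesian_Product" "HOL-Library.Numeral_Type"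
begin

type_synonym cantor = "nat \<Rightarrow> bool"

definition universal :: "(cantor \<times> cantor \<Rightarrow> cantor) \<Rightarrow> bool" where
  "universal F \<longleftrightarrow>
     (\<forall>G :: cantor \<times> cantor \<Rightarrow> cantor. \<exists>g :: cantor \<Rightarrow> cantor.
        \<forall>x y. G (x, y) = F (g x, g y))"

(* The k-th power of the Cantor set is the type of vectors over an index type 'k
   with k elements, so the dimension is CARD('k). *)
definition universal_dim :: "(cantor ^ 'k \<Rightarrow> cantor) \<Rightarrow> bool" where
  "universal_dim F \<longleftrightarrow>
     (\<forall>G :: cantor ^ 'k \<Rightarrow> cantor. \<exists>h :: cantor \<Rightarrow> cantor.
        \<forall>x. G x = F (\<chi> i. h (x $ i)))"

end

(* The composite is handled by coding both layers into one binary function H. Points of the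
   Cantor set are split into codes of single variables x, carrying a free parameter a, and
   codes of pairs (x, y). On two single codes H is F of the two parameters; on a pair code and
   a single code H is G. If g reduces H to F, then every binary function, in particular
   (x, y) \<mapsto> g (code of the pair (x, y)), equals F (l x, l y) for some l. The parameter a is
   still free after g has been chosen, so it may be set to l x: then
   F (g (code of x), g (code of y)) is g (code of the pair (x, y)), and feeding this back into F
   gives G. *)
theory Submission
  imports Defs "HOL-Analysis.Cartesian_Space"
begin

text \<open>The tag separates codes of a single variable \<open>x\<close> with parameter
  \<open>y\<close> (\<open>True\<close>) from codes of a pair (\<open>False\<close>).\<close>

definition enc :: "bool \<Rightarrow> cantor \<Rightarrow> cantor \<Rightarrow> cantor" where
  "enc t x y = case_nat t (\<lambda>n. if even n then x (n div 2) else y (n div 2))"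

definition tag :: "cantor \<Rightarrow> bool" where
  "tag u = u 0"

definition proj1 :: "cantor \<Rightarrow> cantor" where
  "proj1 u = (\<lambda>n. u (Suc (2 * n)))"

definition proj2 :: "cantor \<Rightarrow> cantor" where
  "proj2 u = (\<lambda>n. u (Suc (Suc (2 * n))))"

lemma enc_simps [simp]:
  "tag (enc t x y) = t"
  "proj1 (enc t x y) = x"
  "proj2 (enc t x y) = y"
  by (simp_all add: enc_def tag_def proj1_def proj2_def)

lemma universalD:
  fixes G :: "cantor \<Rightarrow> cantor \<Rightarrow> cantor"
  assumes "universal F"
  shows "\<exists>g. \<forall>x y. F (g x, g y) = G x y"
  using assms[unfolded universal_def, rule_format, of "\<lambda>(x, y). G x y"] by auto

lemma universal_compose:
  fixes G :: "cantor \<Rightarrow> cantor \<Rightarrow> cantor \<Rightarrow> cantor"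
  assumes "universal F"
  shows "\<exists>h. \<forall>x y z. F (F (h x, h y), h z) = G x y z"
proof -
  \<comment> \<open>Only \<open>u\<close> is tested: in both intended uses \<open>v\<close> codes a
    single variable.\<close>
  have "\<exists>g. \<forall>u v. F (g u, g v) =
      (if tag u then F (proj2 u, proj2 v) else G (proj1 u) (proj2 u) (proj1 v))"
    using assms by (rule universalD)
  then obtain g where g: "\<And>u v. F (g u, g v) =
      (if tag u then F (proj2 u, proj2 v) else G (proj1 u) (proj2 u) (proj1 v))"
    by blast
  have "\<exists>l. \<forall>x y. F (l x, l y) = g (enc False x y)"
    using assms by (rule universalD)
  then obtain l where "\<And>x y. F (l x, l y) = g (enc False x y)"
    by blast
  then show ?thesis
    \<comment> \<open>The inner \<open>F\<close> takes the \<open>True\<close> branch, the outer one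
      the \<open>False\<close> branch.\<close>
    by (intro exI[of _ "\<lambda>x. g (enc True x (l x))"]) (simp add: g)
qed

theorem proposition6p2:
  fixes F :: "cantor \<times> cantor \<Rightarrow> cantor"
  assumes "universal F"
  shows "universal_dim (\<lambda>v :: cantor ^ 3. F (F (v $ 1, v $ 2), v $ 3))"
  unfolding universal_dim_def
proof
  fix G :: "cantor ^ 3 \<Rightarrow> cantor"
  \<comment> \<open>The last \<open>else\<close> is index \<open>3\<close>, the only one left in the
    index type.\<close>
  have "\<exists>h. \<forall>x y z. F (F (h x, h y), h z) =
      G (\<chi> i. if i = 1 then x else if i = 2 then y else z)"
    using assms by (rule universal_compose)
  then obtain h where h: "\<And>x y z. F (F (h x, h y), h z) =
      G (\<chi> i. if i = 1 then x else if i = 2 then y else z)"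
    by blast
  have "(\<chi> i. if i = 1 then v $ 1 else if i = 2 then v $ 2 else v $ 3) = v" for v :: "cantor ^ 3"
    by (simp add: vec_eq_iff forall_3)
  then show "\<exists>h. \<forall>v. G v = F (F ((\<chi> i. h (v $ i)) $ 1, (\<chi> i. h (v $ i)) $ 2), (\<chi> i. h (v $ i)) $ 3)"
    by (intro exI[of _ h]) (simp add: h)
qed

end
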